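(* Every Yrrap number is a Perron number.
   Context: For real $\beta>1$, $T_{-\beta}:(0,1]\to(0,1]$, $x\mapsto -\beta x+\lfloor \beta x\rfloor+1$. A real number $\beta>1$ is a Yrrap number if the orbit $(T_{-\beta}^n(1))_{n\ge0}$ is eventually periodic, equivalently if $\{T_{-\beta}^n(1)\mid n\ge0\}$ is a finite set. A Perron number is a real algebraic integer $\beta>1$ all of whose other algebraic conjugates have modulus strictly less than $\beta$. *)

theory Defs
  imports Complex_Main "HOL-Computational_Algebra.Computational_Algebra"
begin

text \<open>
  The map is total on the reals here; the lemma \<open>T_neg_range\<close> below shows that it takes all its
  values in \<open>(0,1]\<close>, so the orbit of \<open>1\<close> is the one of the self-map of \<open>(0,1]\<close>.
\<close>

definition T_neg :: "real \<Rightarrow> real \<Rightarrow> real" where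
  "T_neg \<beta> x = - \<beta> * x + of_int \<lfloor>\<beta> * x\<rfloor> + 1"

lemma T_neg_range: "T_neg \<beta> x \<in> {0<..1}"
proof -
  have "of_int \<lfloor>\<beta> * x\<rfloor> \<le> \<beta> * x" "\<beta> * x < of_int \<lfloor>\<beta> * x\<rfloor> + 1"
    by linarith+
  hence "0 < - \<beta> * x + of_int \<lfloor>\<beta> * x\<rfloor> + 1" "- \<beta> * x + of_int \<lfloor>\<beta> * x\<rfloor> + 1 \<le> 1"
    unfolding mult_minus_left by linarith+
  thus ?thesis unfolding T_neg_def greaterThanAtMost_iff by (rule conjI)
qed

definition eventually_periodic :: "(nat \<Rightarrow> 'a) \<Rightarrow> bool" where
  "eventually_periodic f \<longleftrightarrow> (\<exists>m. \<exists>p>0. \<forall>n\<ge>m. f (n + p) = f n)"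

definition Yrrap :: "real \<Rightarrow> bool" where
  "Yrrap \<beta> \<longleftrightarrow> \<beta> > 1 \<and> eventually_periodic (\<lambda>n. (T_neg \<beta> ^^ n) 1)"

lemma eventually_periodic_orbit_iff_finite:
  fixes f :: "'a \<Rightarrow> 'a"
  shows "eventually_periodic (\<lambda>n. (f ^^ n) x) \<longleftrightarrow> finite (range (\<lambda>n. (f ^^ n) x))"
proof
  assume "eventually_periodic (\<lambda>n. (f ^^ n) x)"
  then obtain m p where p: "p > 0" and per: "\<And>n. n \<ge> m \<Longrightarrow> (f ^^ (n + p)) x = (f ^^ n) x"
    unfolding eventually_periodic_def by blast
  have "(f ^^ n) x \<in> (\<lambda>n. (f ^^ n) x) ` {..<m + p}" for n
  proof (induction n rule: less_induct)
    case (less n)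
    show ?case
    proof (cases "n < m + p")
      case False
      hence "(f ^^ n) x = (f ^^ (n - p)) x"
        using per[of "n - p"] by simp
      thus ?thesis using less.IH[of "n - p"] False p by simp
    qed auto
  qed
  hence "range (\<lambda>n. (f ^^ n) x) \<subseteq> (\<lambda>n. (f ^^ n) x) ` {..<m + p}"
    by blast
  thus "finite (range (\<lambda>n. (f ^^ n) x))"
    by (rule finite_subset) simp
next
  assume "finite (range (\<lambda>n. (f ^^ n) x))"
  hence "\<not> inj (\<lambda>n. (f ^^ n) x)"
    using finite_imageD infinite_UNIV_nat by blast
  then obtain i j where ij: "i < j" "(f ^^ i) x = (f ^^ j) x"
    unfolding inj_on_def by (metis linorder_neqE_nat)
  have "(f ^^ (n + (j - i))) x = (f ^^ n) x" if "n \<ge> i" for n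
  proof -
    have "(f ^^ (n - i + j)) x = (f ^^ (n - i + i)) x"
      using ij(2) by (simp only: funpow_add comp_apply)
    thus ?thesis using that ij(1) by simp
  qed
  moreover have "j - i > 0" using ij(1) by simp
  ultimately show "eventually_periodic (\<lambda>n. (f ^^ n) x)"
    unfolding eventually_periodic_def by blast
qed

lemma Yrrap_iff_finite_orbit:
  "Yrrap \<beta> \<longleftrightarrow> \<beta> > 1 \<and> finite {(T_neg \<beta> ^^ n) 1 | n. True}"
  by (simp add: Yrrap_def eventually_periodic_orbit_iff_finite full_SetCompr_eq)

definition is_minimal_poly :: "rat poly \<Rightarrow> 'a :: field_char_0 \<Rightarrow> bool" where
  "is_minimal_poly p x \<longleftrightarrow>
     lead_coeff p = 1 \<and> irreducible p \<and> poly (map_poly of_rat p) x = 0"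

text \<open>A conjugate in this sense may be equal to \<open>x\<close> itself.\<close>

definition algebraic_conjugate :: "complex \<Rightarrow> complex \<Rightarrow> bool" where
  "algebraic_conjugate x z \<longleftrightarrow>
     (\<exists>p. is_minimal_poly p x \<and> poly (map_poly of_rat p) z = 0)"

definition Perron :: "real \<Rightarrow> bool" where
  "Perron \<beta> \<longleftrightarrow> \<beta> > 1 \<and> algebraic_int \<beta> \<and>
     (\<forall>z. algebraic_conjugate (of_real \<beta>) z \<longrightarrow> z \<noteq> of_real \<beta> \<longrightarrow> norm z < \<beta>)"

end

theory Submission
  imports Defs "HOL-Computational_Algebra.Field_as_Ring"
begin

text \<open>
  Let \<open>W\<close> consist of \<open>0\<close> and the finite orbit of \<open>1\<close>, and let \<open>\<sigma>\<close> send \<open>\<beta>\<close> to a conjugate \<open>z\<close>.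
  An interval \<open>[x, y]\<close> with endpoints in \<open>W\<close> is stretched by \<open>T_neg \<beta>\<close> onto a union of such
  intervals, of total length \<open>\<beta> (y - x)\<close>; applying \<open>\<sigma>\<close> to this identity multiplies \<open>\<sigma> y - \<sigma> x\<close> by \<open>z\<close>.
  Looking at an interval that maximises \<open>|\<sigma> y - \<sigma> x| / (y - x)\<close>, the triangle inequality gives
  \<open>|z| \<le> \<beta>\<close>. If \<open>|z| = \<beta>\<close>, its equality case makes all image intervals maximal again, with the
  direction of \<open>\<sigma> y - \<sigma> x\<close> rotated by \<open>\<omega> = z / \<beta>\<close>. A longest maximal interval cannot be mapped
  injectively, so it has a discontinuity in its interior; one side of it then arrives at \<open>1\<close> one step
  later than the other (\<open>0\<close> is mapped to \<open>1\<close>), and comparing directions at \<open>1\<close> forces \<open>\<omega> = 1\<close>.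
\<close>

section \<open>Equality in the triangle inequality\<close>

text \<open>After division by \<open>e\<close>, the real parts of the summands are at most
  \<open>s\<close> and \<open>t\<close> but add up to \<open>s + t\<close>. So both bounds are
  attained, and the norm bound leaves no room for an imaginary part.\<close>

lemma triangle_equality_left:
  fixes a b e :: complex and s t :: real
  assumes a: "norm a \<le> norm e * s" and b: "norm b \<le> norm e * t"
    and ab: "a + b = e * of_real (s + t)"
  shows "a = e * of_real s"
proof (cases "e = 0")
  case True
  thus ?thesis using a by simp
next
  case False
  define a' b' where "a' = a / e" and "b' = b / e"
  have a': "norm a' \<le> s" and b': "norm b' \<le> t"
    using a b False by (simp_all add: a'_def b'_def norm_divide field_simps)
  have "a' + b' = of_real (s + t)"
    using ab False by (simp add: a'_def b'_def flip: add_divide_distrib)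
  hence "Re a' + Re b' = s + t"
    by (metis plus_complex.sel(1) Re_complex_of_real)
  hence re: "Re a' = s"
    using a' b' complex_Re_le_cmod[of a'] complex_Re_le_cmod[of b'] by linarith
  have "(Re a')\<^sup>2 + (Im a')\<^sup>2 \<le> s\<^sup>2"
    using power_mono[OF a' norm_ge_zero, of 2] by (simp add: cmod_power2)
  hence "a' = of_real s"
    using re by (simp add: complex_eq_iff)
  thus ?thesis using False by (simp add: a'_def field_simps)
qed

lemma triangle_equality:
  fixes a b e :: complex and s t :: real
  assumes "norm a \<le> norm e * s" "norm b \<le> norm e * t" "a + b = e * of_real (s + t)"
  shows "a = e * of_real s" "b = e * of_real t"
  using triangle_equality_left[of a e s b t] triangle_equality_left[of b e t a s] assms
  by (simp_all add: add.commute)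

section \<open>Stretching of intervals with endpoints in a finite invariant set\<close>

lemma Max_attained:
  fixes f :: "'a \<Rightarrow> 'b :: linorder"
  assumes "finite A" "A \<noteq> {}"
  obtains x where "x \<in> A" "\<And>y. y \<in> A \<Longrightarrow> f y \<le> f x"
proof -
  have "Max (f ` A) \<in> f ` A" using assms by (intro Max_in) auto
  then obtain x where "x \<in> A" "f x = Max (f ` A)" by auto
  with assms show thesis by (intro that[of x]) auto
qed

text \<open>
  \<open>\<sigma>\<close> plays the role of the embedding \<open>\<int>[\<beta>] \<rightarrow> \<complex>\<close> sending \<open>\<beta>\<close> to \<open>z\<close>, restricted to \<open>W\<close>.
\<close>

lemma T_neg_equivariant_imp_eq:
  fixes \<beta> :: real and z :: complex and \<sigma> :: "real \<Rightarrow> complex"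
  assumes \<beta>: "\<beta> > 1" and z: "norm z \<ge> \<beta>"
    and W: "finite W" "0 \<in> W" "1 \<in> W" "W \<subseteq> {0..1}" "\<And>x. x \<in> W \<Longrightarrow> T_neg \<beta> x \<in> W"
    and \<sigma>: "\<sigma> 0 = 0" "\<sigma> 1 = 1"
      "\<And>x. x \<in> W \<Longrightarrow> \<sigma> (T_neg \<beta> x) = - z * \<sigma> x + of_int \<lfloor>\<beta> * x\<rfloor> + 1"
  shows "z = of_real \<beta>"
proof -
  define T where "T = T_neg \<beta>"
  define D where "D x y = \<sigma> y - \<sigma> x" for x y
  \<comment> \<open>For \<open>x \<le> y\<close> this counts the jumps of \<open>T\<close> between
    \<open>x\<close> (excluded) and \<open>y\<close> (included).\<close>
  define q where "q x y = \<lfloor>\<beta> * y\<rfloor> - \<lfloor>\<beta> * x\<rfloor>" for x y :: real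
  define P where "P = {(x, y). x \<in> W \<and> y \<in> W \<and> x < y}"
  have T_W: "T x \<in> W" if "x \<in> W" for x using W that by (simp add: T_def)
  have T_pos: "0 < T x" and T_le: "T x \<le> 1" for x
    using T_neg_range[of \<beta> x] by (auto simp: T_def)
  have T0: "T 0 = 1" by (simp add: T_def T_neg_def)
  have q0: "q x y \<ge> 0" if "x \<le> y" for x y
    unfolding q_def using \<beta> that by (simp add: floor_mono)
  have len: "\<beta> * (y - x) = T x - T y + of_int (q x y)" for x y
    by (simp add: T_def T_neg_def q_def algebra_simps)
  have D_len: "z * D x y = D (T y) (T x) + of_int (q x y)" if "x \<in> W" "y \<in> W" for x y
    using that by (simp add: D_def T_def q_def \<sigma> algebra_simps)
  have D01: "D 0 1 = 1" by (simp add: D_def \<sigma>)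
  \<comment> \<open>For \<open>q x y \<ge> 1\<close> the summands are the pieces of the image: from
    0 to \<open>T x\<close>, from \<open>T y\<close> to 1, and \<open>q x y - 1\<close> full copies
    of the unit interval.\<close>
  have split: "D (T y) (T x) + of_int (q x y)
      = D 0 (T x) + (D (T y) 1 + of_real (of_int (q x y - 1)) * D 0 1)" for x y
    by (simp add: D_def \<sigma>)

  have "P \<subseteq> W \<times> W" by (auto simp: P_def)
  hence finP: "finite P" using W(1) finite_subset by blast
  have P01: "(0, 1) \<in> P" using W by (simp add: P_def)
  obtain p where p: "p \<in> P" "\<And>p'. p' \<in> P \<Longrightarrow>
      (case p' of (x, y) \<Rightarrow> norm (D x y) / (y - x)) \<le> (case p of (x, y) \<Rightarrow> norm (D x y) / (y - x))"
    using Max_attained[OF finP] P01 by (metis (no_types, lifting) empty_iff)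
  define c where "c = (case p of (x, y) \<Rightarrow> norm (D x y) / (y - x))"
  have c: "norm (D x y) \<le> c * (y - x)" if "x \<in> W" "y \<in> W" "x \<le> y" for x y
  proof (cases "x = y")
    case False
    hence "norm (D x y) / (y - x) \<le> c"
      using p(2)[of "(x, y)"] that by (simp add: P_def c_def)
    thus ?thesis using False that by (simp add: field_simps)
  qed (simp add: D_def)
  \<comment> \<open>The unit interval has ratio 1; this makes \<open>c\<close> positive and bounds
    the full copies in an image.\<close>
  have c1: "c \<ge> 1" using c[of 0 1] W by (simp add: D01)

  define M where "M = {(x, y) \<in> P. norm (D x y) = c * (y - x)}"
  have "p \<in> M" using p(1) by (auto simp: M_def c_def P_def)
  moreover have "finite M" by (rule finite_subset[OF _ finP]) (auto simp: M_def)
  ultimately obtain x y where M: "(x, y) \<in> M"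
    and longest: "\<And>x' y'. (x', y') \<in> M \<Longrightarrow> y' - x' \<le> y - x"
    using Max_attained[of M "\<lambda>(x, y). y - x"]
    by (metis (no_types, lifting) case_prod_conv empty_iff surj_pair)
  have xy: "x \<in> W" "y \<in> W" "x < y" "norm (D x y) = c * (y - x)"
    using M by (auto simp: M_def P_def)

  have bound: "norm (z * D x y) \<le> c * (\<beta> * (y - x))"
    if "x \<in> W" "y \<in> W" "x \<le> y" for x y
  proof (cases "q x y = 0")
    case True
    have "T y \<le> T x" using len[of y x] True \<beta> that mult_nonneg_nonneg[of \<beta> "y - x"] by simp
    thus ?thesis using c[of "T y" "T x"] that True T_W by (simp add: D_len len)
  next
    case False
    hence q1: "q x y \<ge> 1" using q0[OF that(3)] by linarith
    have "norm (z * D x y) \<le> norm (D 0 (T x)) + (norm (D (T y) 1) + of_int (q x y - 1))"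
      unfolding D_len[OF that(1,2)] split using q1 D01
      by (intro order.trans[OF norm_triangle_ineq] add_left_mono) (simp add: norm_mult del: of_int_diff)
    also have "\<dots> \<le> c * (T x - 0) + (c * (1 - T y) + c * of_int (q x y - 1))"
      using q1 c1 c[of 0 "T x"] c[of "T y" 1] T_pos[of x] T_le[of y] W that T_W
      by (intro add_mono) (auto simp: mult_le_cancel_right1)
    also have "\<dots> = c * (\<beta> * (y - x))" unfolding len by (simp add: algebra_simps)
    finally show ?thesis .
  qed
  have "norm z * (c * (y - x)) \<le> \<beta> * (c * (y - x))"
    using bound[of x y] xy by (simp add: norm_mult mult_ac)
  hence nz: "norm z = \<beta>" using z xy c1 by simp

  define \<omega> where "\<omega> = z / of_real \<beta>"
  have z\<omega>: "z = \<omega> * of_real \<beta>" using \<beta> by (simp add: \<omega>_def)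
  have n\<omega>: "norm \<omega> = 1" using nz \<beta> by (simp add: \<omega>_def norm_divide)

  define aligned where "aligned e x y \<longleftrightarrow> x \<in> W \<and> y \<in> W \<and> norm e = c \<and> D x y = e * of_real (y - x)"
    for e x y
  have n\<omega>e: "norm (\<omega> * e) = norm e" for e by (simp add: norm_mult n\<omega>)
  have in_M: "(x, y) \<in> M" if "aligned e x y" "x < y" for e x y
  proof -
    have "norm (D x y) = c * \<bar>y - x\<bar>"
      using that by (simp add: aligned_def norm_mult del: of_real_diff)
    thus ?thesis using that by (simp add: M_def P_def aligned_def)
  qed
  have image0: "aligned (\<omega> * e) (T y) (T x)" if "aligned e x y" "q x y = 0" for e x y
  proof -
    have "D (T y) (T x) = \<omega> * e * of_real (\<beta> * (y - x))"
      using that D_len[of x y] by (simp add: aligned_def z\<omega> mult_ac)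
    thus ?thesis using that T_W by (simp add: aligned_def len n\<omega>e)
  qed
  have image1: "aligned (\<omega> * e) 0 (T x)" "aligned (\<omega> * e) (T y) 1"
      "q x y \<ge> 2 \<Longrightarrow> aligned (\<omega> * e) 0 1"
    if al: "aligned e x y" and q1: "q x y \<ge> 1" for e x y
  proof -
    define k where "k = real_of_int (q x y - 1)"
    have k: "k \<ge> 0" using q1 by (simp add: k_def)
    have mem: "x \<in> W" "y \<in> W" "T x \<in> W" "T y \<in> W" "norm e = c"
      using al T_W by (auto simp: aligned_def)
    have tot: "D 0 (T x) + (D (T y) 1 + of_real k * D 0 1)
        = \<omega> * e * of_real (T x + ((1 - T y) + k))"
    proof -
      have "D 0 (T x) + (D (T y) 1 + of_real k * D 0 1) = z * D x y"
        by (simp only: D_len[OF mem(1,2)] split k_def)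
      also have "\<dots> = \<omega> * e * of_real (\<beta> * (y - x))"
        using al by (simp add: aligned_def z\<omega> mult_ac)
      also have "\<beta> * (y - x) = T x + ((1 - T y) + k)" by (simp add: len k_def)
      finally show ?thesis .
    qed
    have n1: "norm (D 0 (T x)) \<le> norm (\<omega> * e) * T x"
      using c[of 0 "T x"] T_pos[of x] mem W by (simp add: n\<omega>e)
    have n2: "norm (D (T y) 1) \<le> norm (\<omega> * e) * (1 - T y)"
      using c[of "T y" 1] T_le[of y] mem W by (simp add: n\<omega>e)
    have n3: "norm (of_real k * D 0 1) \<le> norm (\<omega> * e) * k"
      using k c1 mem by (simp add: n\<omega> norm_mult D01 mult_le_cancel_right1)
    have n23: "norm (D (T y) 1 + of_real k * D 0 1) \<le> norm (\<omega> * e) * ((1 - T y) + k)"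
      using norm_triangle_ineq[of "D (T y) 1" "of_real k * D 0 1"] n2 n3
      by (simp add: distrib_left)
    \<comment> \<open>Each of the three summands obeys its own bound and the sum attains the total,
      so the equality case, used twice, fixes all three.\<close>
    note r1 = triangle_equality[OF n1 n23 tot]
    note r2 = triangle_equality[OF n2 n3 r1(2)]
    show "aligned (\<omega> * e) 0 (T x)" "aligned (\<omega> * e) (T y) 1"
      using r1(1) r2(1) mem W by (simp_all add: aligned_def n\<omega>e)
    show "aligned (\<omega> * e) 0 1" if "q x y \<ge> 2"
    proof -
      have "k > 0" using that by (simp add: k_def)
      thus ?thesis using r2(2) mem W n\<omega>e[of e] by (simp add: aligned_def D01)
    qed
  qed
  \<comment> \<open>The equality case passes the slope of the longer interval on to its end piece,
    and \<open>b < 1\<close> makes the slope there unique.\<close>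
  have nested: "e = e'" if "aligned e a 1" "aligned e' b 1" "a \<le> b" "b < 1" for e e' a b
  proof -
    have "D b 1 = e * of_real (1 - b)"
    proof (rule triangle_equality(2))
      show "norm (D a b) \<le> norm e * (b - a)" "norm (D b 1) \<le> norm e * (1 - b)"
        using c[of a b] c[of b 1] that by (auto simp: aligned_def)
      have "D a b + D b 1 = D a 1" by (simp add: D_def)
      thus "D a b + D b 1 = e * of_real (b - a + (1 - b))"
        using that by (simp add: aligned_def)
    qed
    moreover have "D b 1 = e' * of_real (1 - b)" using that by (simp add: aligned_def)
    moreover have "complex_of_real (1 - b) \<noteq> 0"
      using that by (simp del: of_real_diff)
    ultimately show ?thesis by simp
  qed
  have nested': "e = e'" if "aligned e a 1" "aligned e' b 1" "a < 1" "b < 1" for e e' a b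
    using nested[of e a e' b] nested[of e' b e a] that by (cases "a \<le> b") auto
  have e0: "e \<noteq> 0" if "aligned e a b" for e a b using that c1 by (auto simp: aligned_def)
  \<comment> \<open>Since \<open>T 0 = 1\<close>, the first image piece of the unit interval is the
    unit interval again, now with slope \<open>\<omega> * e\<close>.\<close>
  have full: "\<omega> = 1" if "aligned e 0 1" for e
  proof -
    have "q 0 1 \<ge> 1" using \<beta> by (simp add: q_def le_floor_iff)
    hence "aligned (\<omega> * e) 0 (T 0)" using image1(1) that by blast
    hence "\<omega> * e = e" using nested'[of "\<omega> * e" 0 e 0] that by (simp add: T0)
    thus ?thesis using e0[OF that] by simp
  qed

  define e where "e = D x y / of_real (y - x)"
  have al: "aligned e x y"
    using xy by (simp add: aligned_def e_def norm_divide del: of_real_diff)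
  have longer: False if "aligned e' a b" "b - a = \<beta> * (y - x)" for e' a b
  proof -
    have "y - x < \<beta> * (y - x)" using \<beta> xy by simp
    moreover from this have "a < b" using that xy(3) by linarith
    ultimately show False using longest[OF in_M[OF that(1)]] that(2) by linarith
  qed
  have "q x y \<noteq> 0"
    using image0[OF al] longer[of "\<omega> * e" "T y" "T x"] by (auto simp: len)
  hence q1: "q x y \<ge> 1" using q0[of x y] xy by linarith
  note im = image1[OF al q1]
  have "\<omega> = 1"
  proof (cases "q x y \<ge> 2 \<or> q 0 (T x) \<ge> 1")
    \<comment> \<open>Either way the unit interval is aligned: as a full copy in the image, or as
      the first image piece of the interval from 0 to \<open>T x\<close>.\<close>
    case True
    thus ?thesis using im full image1(1)[OF im(1)] T0 by auto
  next
    \<comment> \<open>The interval from 0 to \<open>T x\<close> now has no jump, so its image ends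
      at \<open>T 0 = 1\<close> with slope \<open>\<omega> * (\<omega> * e)\<close>, while the piece
      from \<open>T y\<close> to 1 has slope \<open>\<omega> * e\<close>. Both are shown to be
      nondegenerate before they are compared.\<close>
    case False
    hence q: "q x y = 1" "q 0 (T x) = 0" using q1 q0[of 0 "T x"] T_pos[of x] by auto
    have Ty: "T y < 1"
    proof (rule ccontr)
      assume "\<not> T y < 1"
      \<comment> \<open>The piece from 0 to \<open>T x\<close> would then carry the whole length
        \<open>\<beta> * (y - x)\<close>.\<close>
      hence "T y = 1" using T_le[of y] by simp
      thus False using longer[OF im(1)] q by (simp add: len)
    qed
    have "aligned (\<omega> * (\<omega> * e)) (T (T x)) 1" using image0[OF im(1) q(2)] by (simp add: T0)
    moreover have "T (T x) < 1"
      using len[of "T x" 0] q(2) T0 \<beta> T_pos[of x] mult_pos_pos[of \<beta> "T x"] by simp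
    ultimately have "\<omega> * (\<omega> * e) = \<omega> * e" using nested' im(2) Ty by blast
    thus ?thesis using e0[OF im(2)] by simp
  qed
  thus ?thesis using z\<omega> by simp
qed

section \<open>Integer polynomial relations and conjugates\<close>

text \<open>If the irreducible \<open>p\<close> did not divide \<open>q\<close> over the rationals,
  a Bezout identity evaluated at \<open>x\<close> would read 0 = 1.\<close>

lemma algebraic_conjugate_root:
  fixes q :: "int poly"
  assumes conj: "algebraic_conjugate x z" and q: "poly (map_poly of_int q) x = 0"
  shows "poly (map_poly of_int q) z = 0"
proof -
  obtain p :: "rat poly" where p: "irreducible p" "poly (map_poly of_rat p) x = 0"
      "poly (map_poly of_rat p) z = 0"
    using conj by (auto simp: algebraic_conjugate_def is_minimal_poly_def)
  define r :: "rat poly" where "r = map_poly of_int q"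
  have r: "map_poly of_rat r = (map_poly of_int q :: complex poly)"
    by (simp add: r_def map_poly_map_poly o_def)
  have hom: "map_poly of_rat (a * b) = map_poly of_rat a * (map_poly of_rat b :: complex poly)"
    "map_poly of_rat (a + b) = map_poly of_rat a + (map_poly of_rat b :: complex poly)"
    for a b :: "rat poly"
    by (intro poly_eqI, simp add: coeff_map_poly coeff_mult of_rat_sum of_rat_mult of_rat_add)+
  have "p dvd r"
  proof (rule ccontr)
    assume "\<not> p dvd r"
    hence "coprime p r"
      using p(1) by (metis field_poly_irreducible_imp_prime prime_elem_imp_coprime)
    then obtain a b where "a * p + b * r = 1"
      by (metis bezout_coefficients_fst_snd coprime_iff_gcd_eq_1)
    hence "map_poly of_rat (a * p + b * r) = (1 :: complex poly)" by simp
    hence "poly (map_poly of_rat (a * p + b * r)) x = 1" by simp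
    thus False using p(2) q by (simp add: hom r)
  qed
  then obtain s where "r = p * s" by blast
  hence "map_poly of_int q = map_poly of_rat p * (map_poly of_rat s :: complex poly)"
    using r hom by metis
  thus ?thesis using p(3) by simp
qed

text \<open>Unfolds the iteration with the floors at the actual \<open>\<beta>\<close> frozen as
  integer coefficients, so that orbit points become polynomial values at
  \<open>\<beta>\<close>.\<close>

primrec orbit_poly :: "real \<Rightarrow> nat \<Rightarrow> int poly" where
  "orbit_poly \<beta> 0 = 1"
| "orbit_poly \<beta> (Suc n) = pCons (\<lfloor>\<beta> * (T_neg \<beta> ^^ n) 1\<rfloor> + 1) (- orbit_poly \<beta> n)"

lemma poly_orbit_poly: "poly (map_poly of_int (orbit_poly \<beta> n)) \<beta> = (T_neg \<beta> ^^ n) 1"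
proof (induction n)
  case (Suc n)
  have "map_poly real_of_int (- orbit_poly \<beta> n) = - map_poly of_int (orbit_poly \<beta> n)"
    by (intro poly_eqI) (simp add: coeff_map_poly)
  with Suc show ?case by (simp add: map_poly_pCons T_neg_def[of \<beta> "(T_neg \<beta> ^^ n) 1"])
qed auto

lemma orbit_poly_nz: "orbit_poly \<beta> n \<noteq> 0"
  by (induction n) auto

lemma degree_orbit_poly: "degree (orbit_poly \<beta> n) = n"
  by (induction n) (auto simp: orbit_poly_nz)

lemma lead_coeff_orbit_poly: "lead_coeff (orbit_poly \<beta> n) = (- 1) ^ n"
  by (induction n) (auto simp: orbit_poly_nz)

text \<open>A repetition in the orbit makes the difference of two orbit polynomials of different
  degrees vanish at \<open>\<beta>\<close>; its leading coefficient is a sign.\<close>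

lemma Yrrap_imp_algebraic_int:
  assumes "Yrrap \<beta>"
  shows "algebraic_int \<beta>"
proof -
  obtain m p where p: "p > 0" "(T_neg \<beta> ^^ (m + p)) 1 = (T_neg \<beta> ^^ m) 1"
    using assms by (auto simp: Yrrap_def eventually_periodic_def)
  define r where "r = orbit_poly \<beta> (m + p) - orbit_poly \<beta> m"
  have deg: "degree r = m + p"
    unfolding r_def using p(1) degree_orbit_poly
    by (metis degree_add_eq_left degree_minus less_add_same_cancel1 diff_conv_add_uminus)
  have "lead_coeff r = (- 1) ^ (m + p)"
    using p(1) lead_coeff_orbit_poly[of \<beta> "m + p"]
    by (simp only: deg) (simp add: r_def degree_orbit_poly coeff_eq_0)
  hence lc: "lead_coeff (smult ((- 1) ^ (m + p)) r) = 1"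
    by (simp flip: power_mult_distrib)
  have "map_poly real_of_int (smult ((- 1) ^ (m + p)) r)
      = smult ((- 1) ^ (m + p)) (map_poly of_int (orbit_poly \<beta> (m + p)) - map_poly of_int (orbit_poly \<beta> m))"
    by (intro poly_eqI) (simp add: coeff_map_poly r_def)
  hence "poly (map_poly of_int (smult ((- 1) ^ (m + p)) r)) \<beta> = 0"
    using p(2) by (simp add: poly_orbit_poly)
  with lc show ?thesis by (auto simp: algebraic_int_altdef_ipoly)
qed

lemma Yrrap_conjugate_less:
  assumes "Yrrap \<beta>" "algebraic_conjugate (of_real \<beta>) z" "z \<noteq> of_real \<beta>"
  shows "norm z < \<beta>"
proof (rule ccontr)
  assume "\<not> norm z < \<beta>"
  define orb where "orb n = (T_neg \<beta> ^^ n) 1" for n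
  \<comment> \<open>The point 0 is added because image pieces may start there; as it is mapped to 1,
    \<open>W\<close> stays invariant.\<close>
  define W where "W = insert 0 (range orb)"
  define rep where "rep w q \<longleftrightarrow> poly (map_poly of_int q) \<beta> = w" for w and q :: "int poly"
  define \<sigma> where "\<sigma> w = poly (map_poly of_int (SOME q. rep w q)) z" for w
  \<comment> \<open>The choice in \<open>\<sigma>\<close> is harmless: two representations of
    \<open>w\<close> differ by a polynomial vanishing at \<open>\<beta>\<close>, hence at
    \<open>z\<close>.\<close>
  have \<sigma>_eq: "\<sigma> w = poly (map_poly of_int q) z" if "rep w q" for w q
  proof -
    define q' where "q' = (SOME q. rep w q)"
    have q': "rep w q'" unfolding q'_def using that by (rule someI)
    have sub: "map_poly of_int (q' - q) = (map_poly of_int q' - map_poly of_int q :: 'a :: ring_1 poly)"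
      by (intro poly_eqI) (simp add: coeff_map_poly)
    have "poly (map_poly of_int p) (complex_of_real \<beta>) = of_real (poly (map_poly of_int p) \<beta>)" for p
      by (induction p) (simp_all add: map_poly_pCons)
    hence "poly (map_poly of_int (q' - q)) (complex_of_real \<beta>)
        = of_real (poly (map_poly of_int (q' - q)) \<beta>)" .
    also have "\<dots> = 0" using q' that by (simp add: rep_def sub)
    finally have "poly (map_poly of_int (q' - q)) z = 0"
      by (rule algebraic_conjugate_root[OF assms(2)])
    thus ?thesis by (simp add: \<sigma>_def sub flip: q'_def)
  qed
  have rep: "\<exists>q. rep w q" if "w \<in> W" for w
    using that poly_orbit_poly[of \<beta>] by (auto simp: W_def orb_def rep_def intro: exI[of _ 0])
  have "z = of_real \<beta>"
  proof (rule T_neg_equivariant_imp_eq)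
    show "\<beta> > 1" "norm z \<ge> \<beta>"
      using assms(1) \<open>\<not> norm z < \<beta>\<close> by (simp_all add: Yrrap_def)
    show "finite W"
      using assms(1) by (simp add: W_def orb_def Yrrap_def eventually_periodic_orbit_iff_finite)
    show "0 \<in> W" "1 \<in> W"
      using rangeI[of orb 0] by (simp_all add: W_def orb_def)
    have "orb n \<in> {0<..1}" for n
      by (cases n) (use T_neg_range in \<open>auto simp: orb_def\<close>)
    thus "W \<subseteq> {0..1}" by (auto simp: W_def less_imp_le)
    show "T_neg \<beta> w \<in> W" if "w \<in> W" for w
      using that
    proof (unfold W_def, elim insertE rangeE)
      assume "w = 0"
      thus "T_neg \<beta> w \<in> insert 0 (range orb)"
        using rangeI[of orb 0] by (simp add: orb_def T_neg_def)
    next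
      fix n assume "w = orb n"
      thus "T_neg \<beta> w \<in> insert 0 (range orb)"
        using rangeI[of orb "Suc n"] by (simp add: orb_def)
    qed
    show "\<sigma> 0 = 0" "\<sigma> 1 = 1"
      using \<sigma>_eq[of 0 0] \<sigma>_eq[of 1 1] by (simp_all add: rep_def)
    show "\<sigma> (T_neg \<beta> w) = - z * \<sigma> w + of_int \<lfloor>\<beta> * w\<rfloor> + 1" if w: "w \<in> W" for w
    proof -
      obtain q where q: "rep w q" using rep w by blast
      \<comment> \<open>One step of the map with its floor frozen; evaluation at \<open>z\<close>
        turns it into the required identity.\<close>
      define q' where "q' = pCons (\<lfloor>\<beta> * w\<rfloor> + 1) (- q)"
      have neg: "map_poly of_int (- q) = (- map_poly of_int q :: 'a :: ring_1 poly)"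
        by (intro poly_eqI) (simp add: coeff_map_poly)
      have "rep (T_neg \<beta> w) q'"
        using q by (simp add: rep_def q'_def map_poly_pCons neg T_neg_def)
      thus ?thesis using q by (simp add: \<sigma>_eq q'_def map_poly_pCons neg)
    qed
  qed
  with assms(3) show False by contradiction
qed

theorem theorem2p6:
  fixes \<beta> :: real
  assumes "Yrrap \<beta>"
  shows "Perron \<beta>"
  using assms Yrrap_imp_algebraic_int Yrrap_conjugate_less
  by (auto simp: Perron_def Yrrap_def)

end
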